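(* Let $\gamma\ge0$, $p\in\mathbb{N}$ and $0\le\alpha\le\beta$. For every non-decreasing $f\in B_{\rho_\gamma}(\mathbb{R}_+)$, every $x\ge0$, $\delta>0$ and $n\in\mathbb{N}$, $$|\mathcal{L}^{(\alpha,\beta)}_{n,p}(f,x)-f(x)|\le\sqrt{\mathcal{L}^{(\alpha,\beta)}_{n,p}(\nu_{x,\gamma}^2;x)}\left(1+\frac1\delta\sqrt{\mathcal{L}^{(\alpha,\beta)}_{n,p}(\Psi_x^2;x)}\right)\Omega_{\rho_\gamma}(f;\delta),$$ where $\nu_{x,\gamma}(t):=1+(x+|t-x|)^{2+\gamma}$ and $\Psi_x(t):=|t-x|$ for $t\ge0$.
   Context: $\mathbb{N}$ denotes the positive integers and $\mathbb{R}_+=[0,\infty)$. For $n,p\in\mathbb{N}$, $0\le\alpha\le\beta$ and suitable $f:[0,\infty)\to\mathbb{R}$, the Baskakov-Schurer-Szász-Stancu operator is $$\mathcal{L}^{(\alpha,\beta)}_{n,p}(f,x)=\mathcal{L}^{(\alpha,\beta)}_{n,p}(f;x)=(n+p)\sum_{k=0}^{\infty}b^k_{n,p}(x)\int_0^\infty s^k_{n,p}(t)\,f\left(\frac{nt+\alpha}{n+\beta}\right)dt,\qquad x\in[0,\infty),$$ where $b^k_{n,p}(x)=\binom{n+p+k-1}{k}\frac{x^k}{(1+x)^{n+p+k}}$ and $s^k_{n,p}(t)=e^{-(n+p)t}\frac{((n+p)t)^k}{k!}$. $\rho_\gamma(x)=1+x^{2+\gamma}$, and $B_{\rho_\gamma}(\mathbb{R}_+)$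 is the space of functions $f:[0,\infty)\to\mathbb{R}$ for which there is a constant $M_f$ with $|f(x)|\le M_f\,\rho_\gamma(x)$ for all $x\ge0$. For such $f$ and $\delta>0$, $$\Omega_{\rho_\gamma}(f;\delta)=\sup_{x\ge0,\ 0\le h\le\delta}\frac{|f(x+h)-f(x)|}{1+(x+h)^{2+\gamma}}.$$ *)

theory Defs
  imports "HOL-Analysis.Analysis"
begin

text \<open>
  A function on \<open>[0,\<infinity>)\<close> is represented by a total function on the reals whose values at negative
  arguments are irrelevant: every definition below looks only at arguments in \<open>[0,\<infinity>)\<close>
  (when \<open>0 \<le> \<alpha> \<le> \<beta>\<close> and \<open>n \<ge> 1\<close>).
\<close>

definition baskakov_basis :: "nat \<Rightarrow> nat \<Rightarrow> nat \<Rightarrow> real \<Rightarrow> real" where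
  "baskakov_basis n p k x = real ((n + p + k - 1) choose k) * (x ^ k / (1 + x) ^ (n + p + k))"

definition szasz_basis :: "nat \<Rightarrow> nat \<Rightarrow> nat \<Rightarrow> real \<Rightarrow> real" where
  "szasz_basis n p k t = exp (- (real (n + p) * t)) * ((real (n + p) * t) ^ k / fact k)"

definition BSS_operator ::
    "real \<Rightarrow> real \<Rightarrow> nat \<Rightarrow> nat \<Rightarrow> (real \<Rightarrow> real) \<Rightarrow> real \<Rightarrow> real" where
  "BSS_operator \<alpha> \<beta> n p f x =
     real (n + p) *
       (\<Sum>k. baskakov_basis n p k x *
          (LINT t:{0..}|lborel. szasz_basis n p k t * f ((real n * t + \<alpha>) / (real n + \<beta>))))"

definition weight_fun :: "real \<Rightarrow> real \<Rightarrow> real" where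
  "weight_fun \<gamma> x = 1 + x powr (2 + \<gamma>)"

definition weighted_space :: "real \<Rightarrow> (real \<Rightarrow> real) set" where
  "weighted_space \<gamma> = {f. \<exists>M. \<forall>x\<ge>0. \<bar>f x\<bar> \<le> M * weight_fun \<gamma> x}"

text \<open>
  For \<open>f\<close> in the weighted space and \<open>\<gamma> \<ge> 0\<close> the quotients are bounded (by \<open>2 M\<close>), so the real-valued
  supremum below is a genuine one.
\<close>

definition weighted_modulus :: "real \<Rightarrow> (real \<Rightarrow> real) \<Rightarrow> real \<Rightarrow> real" where
  "weighted_modulus \<gamma> f \<delta> =
     (SUP (x, h) \<in> {0..} \<times> {0..\<delta>}. \<bar>f (x + h) - f x\<bar> / (1 + (x + h) powr (2 + \<gamma>)))"

definition nu_fun :: "real \<Rightarrow> real \<Rightarrow> real \<Rightarrow> real" where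
  "nu_fun \<gamma> x t = 1 + (x + \<bar>t - x\<bar>) powr (2 + \<gamma>)"

definition Psi_fun :: "real \<Rightarrow> real \<Rightarrow> real" where
  "Psi_fun x t = \<bar>t - x\<bar>"

end

theory Submission
  imports Defs "HOL-Probability.Distributions"
begin

text \<open>
  The operator takes the mean of \<open>t \<mapsto> f ((n t + \<alpha>) / (n + \<beta>))\<close> under a probability distribution
  on \<open>[0,\<infinity>)\<close>, a mixture of Erlang distributions: the basis values
  \<open>b\<^sub>k(x)\<close> form a negative binomial distribution in \<open>k\<close>, and \<open>(n + p) s\<^sub>k\<close> is the Erlang density of
  shape \<open>k + 1\<close>. It is therefore a positive linear functional that fixes constants, and it obeys the
  Cauchy--Schwarz inequality.

  The weighted modulus controls an increment of \<open>f\<close> over a step of length at most \<open>\<delta>\<close>. The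
  interval between \<open>x\<close> and \<open>t\<close> splits into at most \<open>1 + \<bar>t - x\<bar> / \<delta>\<close> such steps, none ending beyond
  \<open>x + \<bar>t - x\<bar>\<close>; as the weight increases, this gives
  \<open>\<bar>f t - f x\<bar> \<le> \<nu> t \<cdot> (1 + \<Psi> t / \<delta>) \<cdot> \<Omega>\<close>
  (lemma \<open>increment_le_nu_Psi\<close>). Applying the functional and bounding the means of \<open>\<nu> \<cdot> 1\<close> and
  \<open>\<nu> \<cdot> \<Psi>\<close> by Cauchy--Schwarz yields the claim.

  The analytic burden is convergence: linearity and monotonicity of an infinite series of improper
  integrals need absolute convergence. The functions involved grow slower than every exponential
  \<open>e\<^bsup>\<epsilon>t\<^esup>\<close>, a class closed under sums and products, and exponential moments of small order can be
  computed exactly: the Erlang factor gives \<open>N\<^sup>k / (N - \<epsilon>)\<^bsup>k+1\<^esup>\<close>, after which the sum over \<open>k\<close> is again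
  a negative binomial series, convergent for small \<open>\<epsilon>\<close>.
\<close>

section \<open>Functions of subexponential growth\<close>

definition subexponential :: "(real \<Rightarrow> real) \<Rightarrow> bool" where
  "subexponential g \<longleftrightarrow>
     g \<in> borel_measurable borel \<and> (\<forall>\<epsilon>>0. \<exists>C. \<forall>t\<ge>0. \<bar>g t\<bar> \<le> C * exp (\<epsilon> * t))"

lemma subexponentialI:
  assumes "g \<in> borel_measurable borel"
    and "\<And>\<epsilon>. \<epsilon> > 0 \<Longrightarrow> \<exists>C. \<forall>t\<ge>0. \<bar>g t\<bar> \<le> C * exp (\<epsilon> * t)"
  shows "subexponential g"
  using assms by (auto simp: subexponential_def)

lemma subexponential_measurable: "subexponential g \<Longrightarrow> g \<in> borel_measurable borel"
  by (simp add: subexponential_def)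

lemma subexponential_bound:
  assumes "subexponential g" "\<epsilon> > 0"
  obtains C where "C \<ge> 0" "\<And>t. t \<ge> 0 \<Longrightarrow> \<bar>g t\<bar> \<le> C * exp (\<epsilon> * t)"
proof -
  obtain C where C: "\<forall>t\<ge>0. \<bar>g t\<bar> \<le> C * exp (\<epsilon> * t)"
    using assms by (auto simp: subexponential_def)
  have "C \<ge> 0"
    using C[rule_format, of 0] by simp
  with C that show thesis by blast
qed

lemma subexponential_const: "subexponential (\<lambda>t. c)"
proof (rule subexponentialI)
  fix \<epsilon> :: real assume "\<epsilon> > 0"
  then have "\<bar>c\<bar> \<le> \<bar>c\<bar> * exp (\<epsilon> * t)" if "t \<ge> 0" for t
    using that mult_left_mono[of 1 "exp (\<epsilon> * t)" "\<bar>c\<bar>"] by simp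
  then show "\<exists>C. \<forall>t\<ge>0. \<bar>c\<bar> \<le> C * exp (\<epsilon> * t)" by blast
qed simp

lemma subexponential_add:
  assumes "subexponential g" "subexponential h"
  shows "subexponential (\<lambda>t. g t + h t)"
proof (rule subexponentialI)
  note [measurable] = assms[THEN subexponential_measurable]
  show "(\<lambda>t. g t + h t) \<in> borel_measurable borel" by measurable
  fix \<epsilon> :: real assume \<epsilon>: "\<epsilon> > 0"
  obtain C where C: "\<And>t. t \<ge> 0 \<Longrightarrow> \<bar>g t\<bar> \<le> C * exp (\<epsilon> * t)"
    using subexponential_bound[OF assms(1) \<epsilon>] by blast
  obtain D where D: "\<And>t. t \<ge> 0 \<Longrightarrow> \<bar>h t\<bar> \<le> D * exp (\<epsilon> * t)"
    using subexponential_bound[OF assms(2) \<epsilon>] by blast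
  have "\<bar>g t + h t\<bar> \<le> (C + D) * exp (\<epsilon> * t)" if "t \<ge> 0" for t
    using C[OF that] D[OF that] by (simp add: distrib_right)
  then show "\<exists>C. \<forall>t\<ge>0. \<bar>g t + h t\<bar> \<le> C * exp (\<epsilon> * t)" by blast
qed

lemma subexponential_mult:
  assumes "subexponential g" "subexponential h"
  shows "subexponential (\<lambda>t. g t * h t)"
proof (rule subexponentialI)
  note [measurable] = assms[THEN subexponential_measurable]
  show "(\<lambda>t. g t * h t) \<in> borel_measurable borel" by measurable
  fix \<epsilon> :: real assume "\<epsilon> > 0"
  then have \<epsilon>: "\<epsilon> / 2 > 0" by simp
  obtain C where C: "\<And>t. t \<ge> 0 \<Longrightarrow> \<bar>g t\<bar> \<le> C * exp (\<epsilon> / 2 * t)" "C \<ge> 0"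
    using subexponential_bound[OF assms(1) \<epsilon>] by blast
  obtain D where D: "\<And>t. t \<ge> 0 \<Longrightarrow> \<bar>h t\<bar> \<le> D * exp (\<epsilon> / 2 * t)"
    using subexponential_bound[OF assms(2) \<epsilon>] by blast
  have "\<bar>g t * h t\<bar> \<le> (C * D) * exp (\<epsilon> * t)" if "t \<ge> 0" for t
  proof -
    have "\<bar>g t * h t\<bar> \<le> (C * exp (\<epsilon> / 2 * t)) * (D * exp (\<epsilon> / 2 * t))"
      unfolding abs_mult using C D that by (intro mult_mono) auto
    also have "\<dots> = (C * D) * exp (\<epsilon> / 2 * t + \<epsilon> / 2 * t)"
      by (simp only: exp_add mult_ac)
    finally show ?thesis by simp
  qed
  then show "\<exists>C. \<forall>t\<ge>0. \<bar>g t * h t\<bar> \<le> C * exp (\<epsilon> * t)" by blast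
qed

lemma subexponential_dominated:
  assumes "subexponential h" "g \<in> borel_measurable borel" "\<And>t. t \<ge> 0 \<Longrightarrow> \<bar>g t\<bar> \<le> h t"
  shows "subexponential g"
proof (rule subexponentialI)
  fix \<epsilon> :: real assume "\<epsilon> > 0"
  then obtain C where "\<And>t. t \<ge> 0 \<Longrightarrow> \<bar>h t\<bar> \<le> C * exp (\<epsilon> * t)"
    using subexponential_bound[OF assms(1)] by blast
  then show "\<exists>C. \<forall>t\<ge>0. \<bar>g t\<bar> \<le> C * exp (\<epsilon> * t)"
    using assms(3) by (meson abs_ge_self order_trans)
qed fact

text \<open>
  After rescaling \<open>u\<close> by \<open>\<epsilon> / a\<close>, the bound is \<open>ln y \<le> y\<close> multiplied by \<open>a\<close> and exponentiated.
\<close>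
lemma powr_le_const_mult_exp:
  fixes a \<epsilon> u :: real
  assumes "a > 0" "\<epsilon> > 0" "u \<ge> 0"
  shows "u powr a \<le> (\<epsilon> / a) powr (- a) * exp (\<epsilon> * u)"
proof (cases "u = 0")
  case False
  define \<eta> where "\<eta> = \<epsilon> / a"
  have \<eta>: "\<eta> > 0" and u: "u > 0"
    using assms False by (auto simp: \<eta>_def)
  have "u powr a = \<eta> powr (- a) * (\<eta> * u) powr a"
    using \<eta> u by (simp add: powr_mult powr_minus field_simps)
  also have "(\<eta> * u) powr a \<le> exp (\<epsilon> * u)"
  proof -
    have "ln (\<eta> * u) \<le> \<eta> * u - 1"
      using \<eta> u by (intro ln_le_minus_one) simp
    then have "a * ln (\<eta> * u) \<le> a * (\<eta> * u)"
      using assms by (intro mult_left_mono) auto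
    also have "\<dots> = \<epsilon> * u"
      using assms by (simp add: \<eta>_def)
    finally show ?thesis
      using \<eta> u by (simp add: powr_def)
  qed
  finally show ?thesis
    by (simp add: \<eta>_def mult_left_mono)
qed (use assms in simp)

lemma subexponential_abs_powr:
  assumes "a > 0"
  shows "subexponential (\<lambda>t. (c + \<bar>t - d\<bar>) powr a)"
proof (rule subexponentialI)
  fix \<epsilon> :: real assume \<epsilon>: "\<epsilon> > 0"
  define K where "K = (\<epsilon> / a) powr (- a)"
  have "\<bar>(c + \<bar>t - d\<bar>) powr a\<bar> \<le> (K * exp (\<epsilon> * (\<bar>c\<bar> + \<bar>d\<bar>))) * exp (\<epsilon> * t)" if "t \<ge> 0" for t
  proof -
    \<comment> \<open>for negative base, \<open>powr\<close> takes the logarithm of the absolute value\<close>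
    have "(c + \<bar>t - d\<bar>) powr a = \<bar>c + \<bar>t - d\<bar>\<bar> powr a"
      by (simp add: powr_def ln_real_def abs_if)
    also have "\<dots> \<le> (\<bar>c\<bar> + \<bar>d\<bar> + t) powr a"
      using that assms by (intro powr_mono2) auto
    also have "\<dots> \<le> K * exp (\<epsilon> * (\<bar>c\<bar> + \<bar>d\<bar> + t))"
      unfolding K_def using that assms \<epsilon> by (intro powr_le_const_mult_exp) auto
    finally show ?thesis
      by (simp add: distrib_left exp_add mult_ac)
  qed
  then show "\<exists>C. \<forall>t\<ge>0. \<bar>(c + \<bar>t - d\<bar>) powr a\<bar> \<le> C * exp (\<epsilon> * t)" by blast
qed measurable

lemma subexponential_nu_fun:
  assumes "\<gamma> \<ge> 0"
  shows "subexponential (nu_fun \<gamma> x)"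
  unfolding nu_fun_def[abs_def] using assms
  by (intro subexponential_add subexponential_const subexponential_abs_powr) auto

lemma subexponential_Psi_fun: "subexponential (Psi_fun x)"
proof (rule subexponential_dominated)
  show "subexponential (\<lambda>t. (0 + \<bar>t - x\<bar>) powr 1)"
    by (rule subexponential_abs_powr) simp
qed (auto simp: Psi_fun_def[abs_def])

section \<open>Exponential moments of the kernel\<close>

text \<open>
  Multiplying \<open>s\<^sub>k\<close> by \<open>e\<^bsup>\<epsilon>t\<^esup>\<close> lowers the rate from \<open>N = n + p\<close> to \<open>N - \<epsilon>\<close>, so up to a constant the
  integrand stays an Erlang density.
\<close>
lemma has_bochner_integral_szasz_basis_exp:
  assumes "\<epsilon> < real (n + p)"
  shows "has_bochner_integral lborel
           (\<lambda>t. indicator {0..} t *\<^sub>R (szasz_basis n p k t * exp (\<epsilon> * t)))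
           (real (n + p) ^ k / (real (n + p) - \<epsilon>) ^ Suc k)"
proof -
  define N where "N = real (n + p)"
  define l where "l = N - \<epsilon>"
  have l: "l > 0" using assms by (simp add: l_def N_def)
  have "has_bochner_integral lborel (erlang_density k l) 1"
  proof (rule has_bochner_integral_nn_integral)
    show "(\<integral>\<^sup>+ t. ennreal (erlang_density k l t) \<partial>lborel) = ennreal 1"
      using nn_integral_erlang_ith_moment[OF l, of k 0] by simp
  qed (use l in auto)
  then have "has_bochner_integral lborel
      (\<lambda>t. N ^ k / l ^ Suc k * erlang_density k l t) (N ^ k / l ^ Suc k * 1)"
    by (intro has_bochner_integral_mult_right) auto
  also have "(\<lambda>t. N ^ k / l ^ Suc k * erlang_density k l t)
      = (\<lambda>t. indicator {0..} t *\<^sub>R (szasz_basis n p k t * exp (\<epsilon> * t)))"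
  proof
    fix t :: real
    have "exp (- (N * t)) * exp (\<epsilon> * t) = exp (- l * t)"
      by (simp add: l_def exp_add[symmetric] algebra_simps)
    then show "N ^ k / l ^ Suc k * erlang_density k l t
        = indicator {0..} t *\<^sub>R (szasz_basis n p k t * exp (\<epsilon> * t))"
      using l by (simp add: erlang_density_def szasz_basis_def N_def[symmetric] indicator_def
          power_mult_distrib field_simps del: of_nat_add)
  qed
  finally show ?thesis by (simp add: N_def l_def)
qed

lemma negative_binomial_sums:
  fixes q :: real
  assumes "m \<ge> 1" "\<bar>q\<bar> < 1"
  shows "(\<lambda>k. real ((m + k - 1) choose k) * q ^ k) sums ((1 - q) powr (- real m))"
proof -
  have "(\<lambda>k. (- real m gchoose k) * (- q) ^ k) sums (1 + - q) powr (- real m)"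
    using assms by (intro gen_binomial_real) simp
  also have "(\<lambda>k. (- real m gchoose k) * (- q) ^ k) = (\<lambda>k. real ((m + k - 1) choose k) * q ^ k)"
  proof
    fix k
    have "real m + real k - 1 = real (m + k - 1)"
      using assms by (simp add: of_nat_diff)
    then have "(- real m gchoose k) = (- 1) ^ k * real ((m + k - 1) choose k)"
      by (simp only: gbinomial_minus binomial_gbinomial)
    then show "(- real m gchoose k) * (- q) ^ k = real ((m + k - 1) choose k) * q ^ k"
      by (simp add: power_minus[of q])
  qed
  finally show ?thesis by simp
qed

lemma baskakov_basis_eq:
  assumes "x \<ge> 0"
  shows "baskakov_basis n p k x
    = (1 + x) powr (- real (n + p)) * (real ((n + p + k - 1) choose k) * (x / (1 + x)) ^ k)"
  using assms
  by (simp add: baskakov_basis_def powr_minus powr_realpow power_add power_divide field_simps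
      del: of_nat_add)

lemma baskakov_basis_nonneg: "x \<ge> 0 \<Longrightarrow> baskakov_basis n p k x \<ge> 0"
  by (simp add: baskakov_basis_def)

lemma szasz_basis_nonneg: "t \<ge> 0 \<Longrightarrow> szasz_basis n p k t \<ge> 0"
  by (simp add: szasz_basis_def)

lemma szasz_basis_measurable [measurable]: "szasz_basis n p k \<in> borel_measurable borel"
  unfolding szasz_basis_def[abs_def] by measurable

lemma baskakov_basis_sums:
  assumes "x \<ge> 0" "n + p \<ge> 1"
  shows "(\<lambda>k. baskakov_basis n p k x) sums 1"
proof -
  have "(\<lambda>k. (1 + x) powr (- real (n + p)) * (real ((n + p + k - 1) choose k) * (x / (1 + x)) ^ k))
      sums ((1 + x) powr (- real (n + p)) * (1 - x / (1 + x)) powr (- real (n + p)))"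
    using assms by (intro sums_mult negative_binomial_sums) auto
  also have "1 - x / (1 + x) = 1 / (1 + x)"
    using assms by (simp add: field_simps)
  also have "(1 + x) powr (- real (n + p)) * (1 / (1 + x)) powr (- real (n + p)) = 1"
    using assms by (simp add: powr_mult[symmetric] del: of_nat_add)
  finally show ?thesis
    using assms(1) by (simp only: baskakov_basis_eq)
qed

section \<open>The operator as a positive linear functional\<close>

context
  fixes \<alpha> \<beta> x :: real and n p :: nat
  assumes params: "0 \<le> \<alpha>" "\<alpha> \<le> \<beta>" "x \<ge> 0" "n \<ge> 1" "p \<ge> 1"
begin

abbreviation stancu_node :: "real \<Rightarrow> real" where
  "stancu_node t \<equiv> (real n * t + \<alpha>) / (real n + \<beta>)"

abbreviation szasz_integral :: "(real \<Rightarrow> real) \<Rightarrow> nat \<Rightarrow> real" where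
  "szasz_integral g k \<equiv> (LINT t:{0..}|lborel. szasz_basis n p k t * g (stancu_node t))"

lemma stancu_node_nonneg: "t \<ge> 0 \<Longrightarrow> stancu_node t \<ge> 0"
  using params by simp

lemma stancu_node_le: "t \<ge> 0 \<Longrightarrow> stancu_node t \<le> t + 1"
proof -
  assume "t \<ge> 0"
  then have "0 \<le> t * \<beta>"
    using params by simp
  moreover have "(t + 1) * (real n + \<beta>) - (real n * t + \<alpha>) = t * \<beta> + real n + (\<beta> - \<alpha>)"
    by (simp add: algebra_simps)
  ultimately have "real n * t + \<alpha> \<le> (t + 1) * (real n + \<beta>)"
    using params by linarith
  then show ?thesis
    using params by (simp add: divide_le_eq)
qed

lemma subexponential_node_bound:
  assumes "subexponential g" "\<epsilon> > 0"
  obtains C where "C \<ge> 0"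
    "\<And>t. t \<ge> 0 \<Longrightarrow> \<bar>g (stancu_node t)\<bar> \<le> C * exp (\<epsilon> * t)"
proof -
  obtain C where C: "C \<ge> 0" "\<And>t. t \<ge> 0 \<Longrightarrow> \<bar>g t\<bar> \<le> C * exp (\<epsilon> * t)"
    using subexponential_bound[OF assms] by blast
  have "\<bar>g (stancu_node t)\<bar> \<le> (C * exp \<epsilon>) * exp (\<epsilon> * t)" if "t \<ge> 0" for t
  proof -
    have "\<bar>g (stancu_node t)\<bar> \<le> C * exp (\<epsilon> * stancu_node t)"
      using that by (intro C stancu_node_nonneg)
    also have "\<dots> \<le> C * exp (\<epsilon> * (t + 1))"
      using that C(1) assms(2) stancu_node_le[OF that]
      by (intro mult_left_mono) (auto simp del: times_divide_eq_right)
    finally show ?thesis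
      by (simp add: distrib_left exp_add mult_ac)
  qed
  moreover have "C * exp \<epsilon> \<ge> 0"
    using C(1) by simp
  ultimately show thesis
    using that by blast
qed

lemma szasz_integrand_bounds:
  assumes g: "subexponential g" and \<epsilon>: "\<epsilon> > 0" "\<epsilon> < real (n + p)"
    and C: "\<And>t. t \<ge> 0 \<Longrightarrow> \<bar>g (stancu_node t)\<bar> \<le> C * exp (\<epsilon> * t)"
  shows set_integrable_szasz:
      "set_integrable lborel {0..} (\<lambda>t. szasz_basis n p k t * g (stancu_node t))"
    and abs_szasz_integral_le:
      "\<bar>szasz_integral g k\<bar> \<le> C * (real (n + p) ^ k / (real (n + p) - \<epsilon>) ^ Suc k)"
proof -
  note [measurable] = subexponential_measurable[OF g]
  define h where "h = (\<lambda>t. C * (szasz_basis n p k t * exp (\<epsilon> * t)))"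
  note hb = has_bochner_integral_szasz_basis_exp[OF \<epsilon>(2), of k]
  have hI: "set_integrable lborel {0..} h"
    unfolding h_def using hb
    by (intro set_integrable_mult_right) (simp add: set_integrable_def has_bochner_integral_iff)
  have hV: "(LINT t:{0..}|lborel. h t) = C * (real (n + p) ^ k / (real (n + p) - \<epsilon>) ^ Suc k)"
    unfolding h_def using hb
    by (simp add: set_lebesgue_integral_def has_bochner_integral_iff del: of_nat_add)
  have le: "\<bar>szasz_basis n p k t * g (stancu_node t)\<bar> \<le> h t" if "t \<ge> 0" for t
    using mult_left_mono[OF C[OF that] szasz_basis_nonneg[OF that, of n p k]]
      szasz_basis_nonneg[OF that, of n p k]
    by (simp add: h_def abs_mult mult_ac)
  show I: "set_integrable lborel {0..} (\<lambda>t. szasz_basis n p k t * g (stancu_node t))"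
  proof (rule set_integrable_bound[OF hI])
    show "set_borel_measurable lborel {0..} (\<lambda>t. szasz_basis n p k t * g (stancu_node t))"
      unfolding set_borel_measurable_def by measurable
  qed (use le in force)
  have "\<bar>szasz_integral g k\<bar> \<le> (LINT t:{0..}|lborel. \<bar>szasz_basis n p k t * g (stancu_node t)\<bar>)"
    using set_integral_norm_bound[OF I] by simp
  also have "\<dots> \<le> (LINT t:{0..}|lborel. h t)"
    using le by (intro set_integral_mono set_integrable_abs I hI) auto
  finally show "\<bar>szasz_integral g k\<bar> \<le> C * (real (n + p) ^ k / (real (n + p) - \<epsilon>) ^ Suc k)"
    unfolding hV .
qed

lemma subexponential_set_integrable:
  assumes "subexponential g"
  shows "set_integrable lborel {0..} (\<lambda>t. szasz_basis n p k t * g (stancu_node t))"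
proof -
  have \<epsilon>: "real (n + p) / 2 > 0" "real (n + p) / 2 < real (n + p)"
    using params by auto
  obtain C where "\<And>t. t \<ge> 0 \<Longrightarrow> \<bar>g (stancu_node t)\<bar> \<le> C * exp (real (n + p) / 2 * t)"
    using subexponential_node_bound[OF assms \<epsilon>(1)] by blast
  then show ?thesis
    by (rule set_integrable_szasz[OF assms \<epsilon>])
qed

text \<open>
  The \<open>k\<close>-th term is at most a constant times \<open>binom(N + k - 1, k) r\<^sup>k\<close> with
  \<open>r = x / (1 + x) \<cdot> N / (N - \<epsilon>)\<close>, and \<open>r < 1\<close> as soon as \<open>\<epsilon> (1 + x) < N\<close>.
\<close>
lemma subexponential_summable:
  assumes g: "subexponential g"
  shows "summable (\<lambda>k. baskakov_basis n p k x * szasz_integral g k)"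
proof -
  define N where "N = real (n + p)"
  have N: "N > 0" using params by (simp add: N_def)
  \<comment> \<open>half of the critical value \<open>N / (1 + x)\<close>; it turns the ratio \<open>r\<close> into \<open>x / (x + 1/2)\<close>\<close>
  define \<epsilon> where "\<epsilon> = N / (2 * (1 + x))"
  have \<epsilon>: "\<epsilon> > 0" "\<epsilon> < N"
    using N params by (auto simp: \<epsilon>_def field_simps add_pos_nonneg)
  have crit: "(1 + x) * (N - \<epsilon>) = N * (x + 1 / 2)"
    using params by (simp add: \<epsilon>_def field_simps)
  define r where "r = x / (1 + x) * (N / (N - \<epsilon>))"
  have r: "\<bar>r\<bar> < 1"
  proof -
    have "r = (x * N) / ((1 + x) * (N - \<epsilon>))"
      by (simp add: r_def)
    also have "\<dots> = x / (x + 1 / 2)"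
      using N unfolding crit by simp
    finally show ?thesis
      using params by simp
  qed
  obtain C where C: "C \<ge> 0" "\<And>t. t \<ge> 0 \<Longrightarrow> \<bar>g (stancu_node t)\<bar> \<le> C * exp (\<epsilon> * t)"
    using subexponential_node_bound[OF g \<epsilon>(1)] by blast
  define D where "D = (1 + x) powr (- N) * (C / (N - \<epsilon>))"
  show ?thesis
  proof (rule summable_comparison_test)
    show "summable (\<lambda>k. D * (real ((n + p + k - 1) choose k) * r ^ k))"
      using params r by (intro summable_mult sums_summable[OF negative_binomial_sums]) auto
    have "norm (baskakov_basis n p k x * szasz_integral g k)
        \<le> D * (real ((n + p + k - 1) choose k) * r ^ k)" for k
    proof -
      have "norm (baskakov_basis n p k x * szasz_integral g k)
          = baskakov_basis n p k x * \<bar>szasz_integral g k\<bar>"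
        using baskakov_basis_nonneg params by (simp add: abs_mult)
      also have "\<dots> \<le> baskakov_basis n p k x * (C * (N ^ k / (N - \<epsilon>) ^ Suc k))"
        using abs_szasz_integral_le[OF g \<epsilon>(1) _ C(2)] \<epsilon>(2) baskakov_basis_nonneg params
        unfolding N_def by (intro mult_left_mono) auto
      also have "\<dots> = D * (real ((n + p + k - 1) choose k) * r ^ k)"
        using params
        by (simp add: baskakov_basis_eq N_def[symmetric] D_def r_def power_mult_distrib power_divide
            mult_ac del: of_nat_add)
      finally show ?thesis .
    qed
    then show "\<exists>k0. \<forall>k\<ge>k0. norm (baskakov_basis n p k x * szasz_integral g k)
        \<le> D * (real ((n + p + k - 1) choose k) * r ^ k)" by blast
  qed
qed

lemma BSS_operator_cong:
  assumes "\<And>t. t \<ge> 0 \<Longrightarrow> g t = h t"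
  shows "BSS_operator \<alpha> \<beta> n p g x = BSS_operator \<alpha> \<beta> n p h x"
proof -
  have "szasz_integral g k = szasz_integral h k" for k
    using assms stancu_node_nonneg by (intro set_lebesgue_integral_cong) auto
  then show ?thesis
    by (simp add: BSS_operator_def)
qed

lemma BSS_operator_add:
  assumes "subexponential g" "subexponential h"
  shows "BSS_operator \<alpha> \<beta> n p (\<lambda>t. g t + h t) x
    = BSS_operator \<alpha> \<beta> n p g x + BSS_operator \<alpha> \<beta> n p h x"
proof -
  have "szasz_integral (\<lambda>t. g t + h t) k = szasz_integral g k + szasz_integral h k" for k
    unfolding distrib_left by (intro set_integral_add subexponential_set_integrable assms)
  then have "(\<Sum>k. baskakov_basis n p k x * szasz_integral (\<lambda>t. g t + h t) k)
      = (\<Sum>k. baskakov_basis n p k x * szasz_integral g k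
              + baskakov_basis n p k x * szasz_integral h k)"
    by (simp only: distrib_left)
  also have "\<dots> = (\<Sum>k. baskakov_basis n p k x * szasz_integral g k)
      + (\<Sum>k. baskakov_basis n p k x * szasz_integral h k)"
    by (intro suminf_add[symmetric] subexponential_summable assms)
  finally show ?thesis
    unfolding BSS_operator_def by (simp only: distrib_left)
qed

lemma BSS_operator_cmult:
  assumes "subexponential g"
  shows "BSS_operator \<alpha> \<beta> n p (\<lambda>t. c * g t) x = c * BSS_operator \<alpha> \<beta> n p g x"
proof -
  have scale: "szasz_integral (\<lambda>t. c * g t) k = c * szasz_integral g k" for k
  proof -
    have "szasz_integral (\<lambda>t. c * g t) k
        = (LINT t:{0..}|lborel. c * (szasz_basis n p k t * g (stancu_node t)))"
      by (rule arg_cong[where f = "set_lebesgue_integral lborel {0..}"]) (auto simp: mult_ac)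
    also have "\<dots> = c * szasz_integral g k"
      by (rule set_integral_mult_right)
    finally show ?thesis .
  qed
  have "(\<Sum>k. baskakov_basis n p k x * szasz_integral (\<lambda>t. c * g t) k)
      = (\<Sum>k. c * (baskakov_basis n p k x * szasz_integral g k))"
    unfolding scale by (simp only: mult.left_commute[of _ c "szasz_integral g _"])
  also have "\<dots> = c * (\<Sum>k. baskakov_basis n p k x * szasz_integral g k)"
    by (intro suminf_mult subexponential_summable assms)
  finally show ?thesis
    unfolding BSS_operator_def by (simp only: mult.left_commute[of _ c])
qed

lemma BSS_operator_mono:
  assumes "subexponential g" "subexponential h" "\<And>t. t \<ge> 0 \<Longrightarrow> g t \<le> h t"
  shows "BSS_operator \<alpha> \<beta> n p g x \<le> BSS_operator \<alpha> \<beta> n p h x"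
proof -
  have "szasz_integral g k \<le> szasz_integral h k" for k
  proof (intro set_integral_mono subexponential_set_integrable assms(1,2))
    fix t :: real assume "t \<in> {0..}"
    then show "szasz_basis n p k t * g (stancu_node t) \<le> szasz_basis n p k t * h (stancu_node t)"
      by (intro mult_left_mono assms(3) stancu_node_nonneg szasz_basis_nonneg) simp_all
  qed
  then have "baskakov_basis n p k x * szasz_integral g k
      \<le> baskakov_basis n p k x * szasz_integral h k" for k
    by (intro mult_left_mono baskakov_basis_nonneg params)
  then have "(\<Sum>k. baskakov_basis n p k x * szasz_integral g k)
      \<le> (\<Sum>k. baskakov_basis n p k x * szasz_integral h k)"
    by (intro suminf_le subexponential_summable assms(1,2))
  then show ?thesis
    unfolding BSS_operator_def by (rule mult_left_mono) simp
qed

lemma BSS_operator_const: "BSS_operator \<alpha> \<beta> n p (\<lambda>t. c) x = c"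
proof -
  have "0 < real (n + p)" using params by simp
  then have "szasz_integral (\<lambda>t. 1) k = 1 / real (n + p)" for k
    using has_bochner_integral_szasz_basis_exp[of 0 n p k] params
    by (simp add: set_lebesgue_integral_def has_bochner_integral_iff del: of_nat_add)
  moreover have "(\<lambda>k. baskakov_basis n p k x * (1 / real (n + p))) sums (1 * (1 / real (n + p)))"
    using params by (intro sums_mult2 baskakov_basis_sums) auto
  ultimately have "BSS_operator \<alpha> \<beta> n p (\<lambda>t. 1) x = 1"
    using params unfolding BSS_operator_def by (simp only: sums_iff) simp
  then show ?thesis
    using BSS_operator_cmult[OF subexponential_const, of c 1] by simp
qed

text \<open>
  The usual argument for a positive semidefinite form: the functional is nonnegative on
  \<open>(c g - h)\<^sup>2\<close> for all \<open>c\<close>, so the quadratic polynomial in \<open>c\<close> so obtained has discriminant at most \<open>0\<close>.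
\<close>
lemma BSS_operator_Cauchy_Schwarz:
  assumes g: "subexponential g" and h: "subexponential h"
  shows "BSS_operator \<alpha> \<beta> n p (\<lambda>t. g t * h t) x
    \<le> sqrt (BSS_operator \<alpha> \<beta> n p (\<lambda>t. (g t)\<^sup>2) x) * sqrt (BSS_operator \<alpha> \<beta> n p (\<lambda>t. (h t)\<^sup>2) x)"
proof -
  let ?L = "\<lambda>g. BSS_operator \<alpha> \<beta> n p g x"
  define A B M where "A = ?L (\<lambda>t. (g t)\<^sup>2)" and "B = ?L (\<lambda>t. (h t)\<^sup>2)"
    and "M = ?L (\<lambda>t. g t * h t)"
  note sub = subexponential_add subexponential_mult subexponential_const g h
  have quad: "0 \<le> c\<^sup>2 * A + ((- 2 * c) * M + B)" for c
  proof -
    have "0 = ?L (\<lambda>t. 0)" by (simp add: BSS_operator_const)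
    also have "\<dots> \<le> ?L (\<lambda>t. c\<^sup>2 * (g t * g t) + ((- 2 * c) * (g t * h t) + h t * h t))"
    proof (intro BSS_operator_mono sub)
      fix t
      have "c\<^sup>2 * (g t * g t) + ((- 2 * c) * (g t * h t) + h t * h t) = (c * g t - h t)\<^sup>2"
        by (simp add: power2_eq_square algebra_simps)
      then show "0 \<le> c\<^sup>2 * (g t * g t) + ((- 2 * c) * (g t * h t) + h t * h t)" by simp
    qed
    also have "\<dots> = c\<^sup>2 * ?L (\<lambda>t. g t * g t)
        + ((- 2 * c) * ?L (\<lambda>t. g t * h t) + ?L (\<lambda>t. h t * h t))"
      by (simp only: BSS_operator_add BSS_operator_cmult sub)
    finally show ?thesis
      by (simp add: A_def B_def M_def power2_eq_square)
  qed
  have "0 \<le> ?L (\<lambda>t. g t * g t)"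
    using BSS_operator_mono[of "\<lambda>t. 0" "\<lambda>t. g t * g t"] by (simp add: BSS_operator_const sub)
  then have A: "A \<ge> 0" by (simp add: A_def power2_eq_square)
  have "M\<^sup>2 \<le> A * B"
  proof (cases "A = 0")
    case True
    \<comment> \<open>the quadratic polynomial is then affine in \<open>c\<close>; at this \<open>c\<close> it would equal \<open>-1\<close>\<close>
    have "M = 0"
      using quad[of "(B + 1) / (2 * M)"] True by (cases "M = 0") (auto simp: field_simps)
    then show ?thesis using True by simp
  next
    case False
    then have "0 \<le> A * ((M / A)\<^sup>2 * A + ((- 2 * (M / A)) * M + B))"
      using A quad[of "M / A"] by simp
    also have "\<dots> = A * B - M\<^sup>2"
      using False by (simp add: power2_eq_square field_simps)
    finally show ?thesis by simp
  qed
  then have "\<bar>M\<bar> \<le> sqrt (A * B)"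
    by (rule real_le_rsqrt[OF order_trans[rotated]]) simp
  then show ?thesis
    by (simp add: A_def B_def M_def real_sqrt_mult)
qed

end

section \<open>Increments and the weighted modulus\<close>

text \<open>
  Both values of \<open>f\<close> are at most \<open>M\<close> times the weight at the larger argument, so the quotients
  are bounded by \<open>2 M\<close> and the real supremum does bound each of them.
\<close>
lemma increment_le_weighted_modulus:
  assumes "\<gamma> \<ge> 0" and f: "f \<in> weighted_space \<gamma>" and "x \<ge> 0" "0 \<le> h" "h \<le> \<delta>"
  shows "\<bar>f (x + h) - f x\<bar> \<le> (1 + (x + h) powr (2 + \<gamma>)) * weighted_modulus \<gamma> f \<delta>"
proof -
  obtain M where M: "\<And>x. x \<ge> 0 \<Longrightarrow> \<bar>f x\<bar> \<le> M * weight_fun \<gamma> x"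
    using f by (auto simp: weighted_space_def)
  have M0: "M \<ge> 0"
    using M[of 0] by (simp add: weight_fun_def)
  define Q where "Q = (\<lambda>(x, h). \<bar>f (x + h) - f x\<bar> / (1 + (x + h) powr (2 + \<gamma>)))"
  have w: "1 + u powr (2 + \<gamma>) > 0" for u
    by (simp add: add_pos_nonneg)
  have "Q z \<le> 2 * M" if "z \<in> {0..} \<times> {0..\<delta>}" for z
  proof -
    obtain y k where z: "z = (y, k)" "y \<ge> 0" "k \<ge> 0"
      using \<open>z \<in> _\<close> by auto
    have "M * weight_fun \<gamma> y \<le> M * weight_fun \<gamma> (y + k)"
      using M0 z assms(1) by (intro mult_left_mono) (auto simp: weight_fun_def intro: powr_mono2)
    then have "\<bar>f (y + k) - f y\<bar> \<le> 2 * M * weight_fun \<gamma> (y + k)"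
      using M[of y] M[of "y + k"] z by simp
    then show ?thesis
      using w by (simp add: z Q_def weight_fun_def divide_le_eq)
  qed
  then have "bdd_above (Q ` ({0..} \<times> {0..\<delta>}))"
    by (intro bdd_aboveI2)
  then have "Q (x, h) \<le> weighted_modulus \<gamma> f \<delta>"
    unfolding weighted_modulus_def Q_def[symmetric] using assms by (intro cSUP_upper) auto
  then show ?thesis
    using w[of "x + h"] by (simp add: Q_def divide_le_eq mult.commute)
qed

lemma weighted_modulus_nonneg:
  assumes "\<gamma> \<ge> 0" "f \<in> weighted_space \<gamma>" "\<delta> > 0"
  shows "weighted_modulus \<gamma> f \<delta> \<ge> 0"
  using increment_le_weighted_modulus[OF assms(1,2), of 0 0 \<delta>] assms(3) by simp

lemma increment_le_steps:
  assumes "\<gamma> \<ge> 0" "f \<in> weighted_space \<gamma>" "\<delta> > 0" "a \<ge> 0" "0 \<le> h" "h \<le> \<delta>"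
    and "a + real m * h \<le> c"
  shows "\<bar>f (a + real m * h) - f a\<bar>
    \<le> real m * ((1 + c powr (2 + \<gamma>)) * weighted_modulus \<gamma> f \<delta>)"
  using assms(7)
proof (induction m)
  case (Suc m)
  let ?y = "a + real m * h"
  have y: "?y \<ge> 0" "a + real (Suc m) * h = ?y + h"
    using assms by (auto simp: algebra_simps)
  have "\<bar>f (?y + h) - f ?y\<bar> \<le> (1 + (?y + h) powr (2 + \<gamma>)) * weighted_modulus \<gamma> f \<delta>"
    using assms y(1) by (intro increment_le_weighted_modulus) auto
  also have "\<dots> \<le> (1 + c powr (2 + \<gamma>)) * weighted_modulus \<gamma> f \<delta>"
    using assms y Suc.prems
    by (intro mult_right_mono weighted_modulus_nonneg add_left_mono powr_mono2) auto
  finally have "\<bar>f (?y + h) - f ?y\<bar> \<le> (1 + c powr (2 + \<gamma>)) * weighted_modulus \<gamma> f \<delta>" .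
  moreover have "\<bar>f ?y - f a\<bar> \<le> real m * ((1 + c powr (2 + \<gamma>)) * weighted_modulus \<gamma> f \<delta>)"
    using Suc.IH Suc.prems assms y by simp
  ultimately have "\<bar>f (?y + h) - f a\<bar>
      \<le> real m * ((1 + c powr (2 + \<gamma>)) * weighted_modulus \<gamma> f \<delta>)
        + 1 * ((1 + c powr (2 + \<gamma>)) * weighted_modulus \<gamma> f \<delta>)"
    unfolding mult_1 by linarith
  also have "\<dots> = real (Suc m) * ((1 + c powr (2 + \<gamma>)) * weighted_modulus \<gamma> f \<delta>)"
    by (simp only: distrib_right[symmetric] of_nat_Suc add.commute)
  finally show ?case
    unfolding y(2) .
qed simp

lemma increment_le_weight:
  assumes "\<gamma> \<ge> 0" "f \<in> weighted_space \<gamma>" "\<delta> > 0" "0 \<le> a" "a \<le> b" "b \<le> c"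
  shows "\<bar>f b - f a\<bar> \<le> (1 + c powr (2 + \<gamma>)) * (1 + (b - a) / \<delta>) * weighted_modulus \<gamma> f \<delta>"
proof (cases "a = b")
  case True
  then show ?thesis
    using weighted_modulus_nonneg[OF assms(1-3)] by (simp add: add_nonneg_nonneg)
next
  case False
  define m where "m = nat \<lceil>(b - a) / \<delta>\<rceil>"
  have pos: "(b - a) / \<delta> > 0"
    using False assms by simp
  have m: "real m \<ge> (b - a) / \<delta>" "real m \<le> 1 + (b - a) / \<delta>"
    using pos unfolding m_def by linarith+
  then have m0: "real m > 0"
    using pos by linarith
  define h where "h = (b - a) / real m"
  have h: "0 \<le> h" "h \<le> \<delta>" "a + real m * h = b"
    using m m0 assms by (auto simp: h_def field_simps)
  let ?W = "(1 + c powr (2 + \<gamma>)) * weighted_modulus \<gamma> f \<delta>"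
  have "\<bar>f b - f a\<bar> \<le> real m * ?W"
    using increment_le_steps[OF assms(1-4) h(1,2), of m c] h(3) assms(6) by simp
  also have "\<dots> \<le> (1 + (b - a) / \<delta>) * ?W"
    using m(2) weighted_modulus_nonneg[OF assms(1-3)]
    by (intro mult_right_mono mult_nonneg_nonneg) (auto intro: add_nonneg_nonneg)
  finally show ?thesis
    by (simp only: mult_ac)
qed

lemma increment_le_nu_Psi:
  assumes "\<gamma> \<ge> 0" "f \<in> weighted_space \<gamma>" "\<delta> > 0" "x \<ge> 0" "t \<ge> 0"
  shows "\<bar>f t - f x\<bar> \<le> nu_fun \<gamma> x t * (1 + Psi_fun x t / \<delta>) * weighted_modulus \<gamma> f \<delta>"
proof (cases "x \<le> t")
  case True
  then show ?thesis
    using increment_le_weight[OF assms(1-3), of x t "x + \<bar>t - x\<bar>"] assms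
    by (simp add: nu_fun_def Psi_fun_def)
next
  case False
  then show ?thesis
    using increment_le_weight[OF assms(1-3), of t x "x + \<bar>t - x\<bar>"] assms
    by (simp add: nu_fun_def Psi_fun_def abs_minus_commute)
qed

section \<open>The weighted approximation estimate\<close>

text \<open>
  Only the values on \<open>[0,\<infinity>)\<close> are constrained, so \<open>f\<close> is first extended by the constant \<open>f 0\<close>; the
  extension is monotone on the whole line and hence Borel measurable.
\<close>
lemma subexponential_extension:
  assumes "\<gamma> \<ge> 0" "f \<in> weighted_space \<gamma>" "mono_on {0..} f"
  shows "subexponential (\<lambda>t. f (max 0 t))"
proof -
  obtain M where M: "\<And>t. t \<ge> 0 \<Longrightarrow> \<bar>f t\<bar> \<le> M * weight_fun \<gamma> t"
    using assms(2) by (auto simp: weighted_space_def)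
  have "mono (\<lambda>t. f (max 0 t))"
    by (rule monoI, rule mono_onD[OF assms(3)]) auto
  then have meas: "(\<lambda>t. f (max 0 t)) \<in> borel_measurable borel"
    by (rule borel_measurable_mono)
  show ?thesis
  proof (rule subexponential_dominated[OF _ meas])
    show "subexponential (\<lambda>t. M * (1 + (0 + \<bar>t - 0\<bar>) powr (2 + \<gamma>)))"
      using assms(1)
      by (intro subexponential_mult subexponential_add subexponential_const
          subexponential_abs_powr) auto
  qed (use M in \<open>auto simp: weight_fun_def\<close>)
qed

theorem theorem9:
  fixes \<gamma> \<alpha> \<beta> x \<delta> :: real and n p :: nat and f :: "real \<Rightarrow> real"
  assumes "\<gamma> \<ge> 0"
    and "p \<ge> 1"
    and "0 \<le> \<alpha>" and "\<alpha> \<le> \<beta>"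
    and "f \<in> weighted_space \<gamma>"
    and "mono_on {0..} f"
    and "x \<ge> 0"
    and "\<delta> > 0"
    and "n \<ge> 1"
  shows "\<bar>BSS_operator \<alpha> \<beta> n p f x - f x\<bar>
    \<le> sqrt (BSS_operator \<alpha> \<beta> n p (\<lambda>t. (nu_fun \<gamma> x t)\<^sup>2) x)
      * (1 + 1 / \<delta> * sqrt (BSS_operator \<alpha> \<beta> n p (\<lambda>t. (Psi_fun x t)\<^sup>2) x))
      * weighted_modulus \<gamma> f \<delta>"
proof -
  let ?L = "\<lambda>g. BSS_operator \<alpha> \<beta> n p g x"
  note params = assms(3,4,7,9,2)
  define \<Omega> where "\<Omega> = weighted_modulus \<gamma> f \<delta>"
  have \<Omega>: "\<Omega> \<ge> 0"
    unfolding \<Omega>_def using assms by (intro weighted_modulus_nonneg)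
  define F where "F = (\<lambda>t. f (max 0 t))"
  have F: "subexponential F"
    unfolding F_def using assms by (intro subexponential_extension)
  have LF: "?L f = ?L F"
    by (rule BSS_operator_cong[OF params]) (simp add: F_def)
  define H where "H = (\<lambda>t. nu_fun \<gamma> x t * 1 + 1 / \<delta> * (nu_fun \<gamma> x t * Psi_fun x t))"
  note sub = subexponential_add subexponential_mult subexponential_const
    subexponential_nu_fun[OF assms(1)] subexponential_Psi_fun F
  have H: "subexponential H"
    unfolding H_def by (intro sub)
  have FH: "\<bar>F t - f x\<bar> \<le> \<Omega> * H t" if "t \<ge> 0" for t
  proof -
    have "nu_fun \<gamma> x t * (1 + Psi_fun x t / \<delta>) = H t"
      by (simp add: H_def distrib_left)
    then show ?thesis
      using increment_le_nu_Psi[OF assms(1,5,8,7) that] that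
      by (simp add: F_def \<Omega>_def mult.commute)
  qed
  have LH: "?L (\<lambda>t. f x + c * H t) = f x + c * ?L H" for c
    by (simp only: BSS_operator_add[OF params] BSS_operator_cmult[OF params]
        BSS_operator_const[OF params] sub H)
  have "?L F \<le> ?L (\<lambda>t. f x + \<Omega> * H t)"
    by (intro BSS_operator_mono[OF params] sub H) (use FH in \<open>force simp: abs_le_iff\<close>)
  moreover have "?L (\<lambda>t. f x + (- \<Omega>) * H t) \<le> ?L F"
    by (intro BSS_operator_mono[OF params] sub H) (use FH in \<open>force simp: abs_le_iff\<close>)
  ultimately have "\<bar>?L f - f x\<bar> \<le> \<Omega> * ?L H"
    unfolding LH LF by (simp add: abs_le_iff)
  also have "?L H = ?L (\<lambda>t. nu_fun \<gamma> x t * 1) + 1 / \<delta> * ?L (\<lambda>t. nu_fun \<gamma> x t * Psi_fun x t)"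
    unfolding H_def by (simp only: BSS_operator_add[OF params] BSS_operator_cmult[OF params] sub)
  also have "\<Omega> * \<dots> \<le> \<Omega> * (sqrt (?L (\<lambda>t. (nu_fun \<gamma> x t)\<^sup>2)) * sqrt (?L (\<lambda>t. 1\<^sup>2))
      + 1 / \<delta> * (sqrt (?L (\<lambda>t. (nu_fun \<gamma> x t)\<^sup>2)) * sqrt (?L (\<lambda>t. (Psi_fun x t)\<^sup>2))))"
    using \<Omega> assms(8)
    by (intro mult_left_mono add_mono BSS_operator_Cauchy_Schwarz[OF params] sub) auto
  also have "?L (\<lambda>t. 1\<^sup>2) = 1"
    by (rule trans[OF BSS_operator_const[OF params]]) simp
  finally show ?thesis
    by (simp add: \<Omega>_def algebra_simps)
qed

end
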